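(* Let $\ell\ge 2$ be an integer and let $\mathcal{H}=\{C_3,C_5,\ldots,C_{2\ell-1}\}$. Then $\mathrm{ex}_r(n,\mathcal{H})=\frac n2$ for even $n$, and $\mathrm{ex}_r(n,\mathcal{H})=2\lfloor \frac{n}{2\ell+1}\rfloor-o(1)$ as $n\to\infty$ through odd values of $n$.
   Context: For a family of graphs $\mathcal H$, $\mathrm{ex}_r(n,\mathcal H)$ denotes the maximum integer $k$ such that there exists a $k$-regular graph on $n$ vertices containing no member of $\mathcal H$ as a subgraph. $C_m$ is the cycle of length $m$. Graphs are finite and simple. *)

theory Defs
  imports Complex_Main "HOL-Library.Landau_Symbols"
begin

text \<open>A graph is a pair of a vertex set and a set of edges, each edge being the set of its two ends.\<close>

type_synonym 'a graph = "'a set \<times> 'a set set"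

abbreviation verts :: "'a graph \<Rightarrow> 'a set" where "verts G \<equiv> fst G"

abbreviation edges :: "'a graph \<Rightarrow> 'a set set" where "edges G \<equiv> snd G"

definition simple_graph :: "'a graph \<Rightarrow> bool" where
  "simple_graph G \<longleftrightarrow> finite (verts G) \<and> (\<forall>e\<in>edges G. e \<subseteq> verts G \<and> card e = 2)"

definition vdegree :: "'a graph \<Rightarrow> 'a \<Rightarrow> nat" where
  "vdegree G v = card {e \<in> edges G. v \<in> e}"

definition regular_graph :: "nat \<Rightarrow> 'a graph \<Rightarrow> bool" where
  "regular_graph k G \<longleftrightarrow> (\<forall>v\<in>verts G. vdegree G v = k)"

definition is_subgraph :: "'a graph \<Rightarrow> 'a graph \<Rightarrow> bool" where
  "is_subgraph K G \<longleftrightarrow> verts K \<subseteq> verts G \<and> edges K \<subseteq> edges G"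

definition graph_iso :: "'a graph \<Rightarrow> 'b graph \<Rightarrow> bool" where
  "graph_iso H K \<longleftrightarrow> (\<exists>f. bij_betw f (verts H) (verts K) \<and> edges K = (\<lambda>e. f ` e) ` edges H)"

definition contains_graph :: "'a graph \<Rightarrow> 'b graph \<Rightarrow> bool" where
  "contains_graph G H \<longleftrightarrow> (\<exists>K. is_subgraph K G \<and> graph_iso H K)"

text \<open>This is the cycle of length \<open>m\<close> only for \<open>m \<ge> 3\<close>.\<close>

definition cycle_graph :: "nat \<Rightarrow> nat graph" where
  "cycle_graph m = ({..<m}, {{i, Suc i mod m} | i. i < m})"

definition odd_cycles :: "nat \<Rightarrow> nat graph set" where
  "odd_cycles l = cycle_graph ` {m. odd m \<and> 3 \<le> m \<and> m \<le> 2 * l - 1}"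

text \<open>
  Every finite graph has an isomorphic copy with vertices in \<open>nat\<close>. The maximum is meaningful
  only for \<open>n > 0\<close>: the graph without vertices is \<open>k\<close>-regular for every \<open>k\<close>.
\<close>

definition ex_r :: "nat \<Rightarrow> 'b graph set \<Rightarrow> nat" where
  "ex_r n \<H> = Max {k. \<exists>G :: nat graph. simple_graph G \<and> card (verts G) = n \<and>
     regular_graph k G \<and> (\<forall>H\<in>\<H>. \<not> contains_graph G H)}"

end

theory Submission imports Defs
begin

text \<open>
  For even \<open>n\<close> the extremal graph is the balanced complete bipartite graph, and adjacent vertices of a
  triangle-free graph have disjoint neighbourhoods.

  For odd \<open>n\<close> a \<open>k\<close>-regular graph has even \<open>k\<close>, and if \<open>k > 0\<close> it is not bipartite. On a shortest odd
  cycle, of length \<open>m \<ge> 2l + 1 \<ge> 5\<close>, every vertex of the graph has at most two neighbours, so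
  \<open>mk \<le> 2n\<close>; as \<open>k\<close> is even, \<open>k \<le> 2\<lfloor>n / (2l + 1)\<rfloor>\<close>. Conversely, write \<open>n = (2l + 1)t + r\<close> with
  \<open>r \<le> 2l\<close>. For large \<open>t\<close>, a blow-up of the cycle of length \<open>2l + 1\<close> with parts of size close to \<open>t\<close>
  becomes \<open>2t\<close>-regular on removing sparse bipartite graphs between parts \<open>2l, 0\<close>, parts \<open>0, 1\<close> and
  parts \<open>1, 2\<close>. A graph that maps homomorphically to this cycle has no shorter odd cycle, since the
  steps \<open>\<plusminus>1\<close> along an odd closed walk have an odd sum divisible by \<open>2l + 1\<close>.
\<close>

section \<open>Adjacency as a relation and cycles as subgraphs\<close>

text \<open>In relational form, neighbourhoods are images of singletons and walks of length
  \<open>m\<close> are \<open>m\<close>-th powers.\<close>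

definition adj :: "'a graph \<Rightarrow> 'a rel" where
  "adj G = {(x, y). {x, y} \<in> edges G}"

lemma sym_adj: "sym (adj G)"
  by (auto simp: adj_def sym_def insert_commute)

lemma adj_irrefl: "simple_graph G \<Longrightarrow> (x, x) \<notin> adj G"
  by (auto simp: adj_def simple_graph_def)

lemma adj_subset: "simple_graph G \<Longrightarrow> adj G \<subseteq> verts G \<times> verts G"
  by (auto simp: adj_def simple_graph_def)

lemma vdegree_eq_card_adj:
  assumes "simple_graph G"
  shows "vdegree G v = card (adj G `` {v})"
proof -
  have "bij_betw (\<lambda>y. {v, y}) (adj G `` {v}) {e \<in> edges G. v \<in> e}"
    unfolding bij_betw_def
  proof
    show "inj_on (\<lambda>y. {v, y}) (adj G `` {v})"
      by (auto simp: inj_on_def doubleton_eq_iff)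
    show "(\<lambda>y. {v, y}) ` (adj G `` {v}) = {e \<in> edges G. v \<in> e}"
    proof (intro equalityI subsetI)
      fix e assume "e \<in> {e \<in> edges G. v \<in> e}"
      moreover from this assms have "card e = 2" by (auto simp: simple_graph_def)
      ultimately show "e \<in> (\<lambda>y. {v, y}) ` (adj G `` {v})"
        by (auto simp: card_2_iff adj_def insert_commute)
    qed (auto simp: adj_def)
  qed
  then show ?thesis
    unfolding vdegree_def by (metis bij_betw_same_card)
qed

lemma contains_cycleI:
  assumes G: "simple_graph G" and inj: "inj_on f {..<m}"
    and f: "\<And>i. i < m \<Longrightarrow> (f i, f (Suc i mod m)) \<in> adj G"
  shows "contains_graph G (cycle_graph m)"
proof -
  let ?K = "(f ` {..<m}, (\<lambda>e. f ` e) ` edges (cycle_graph m))"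
  have "is_subgraph ?K G"
    using f adj_subset[OF G] by (auto simp: is_subgraph_def cycle_graph_def adj_def)
  moreover have "graph_iso (cycle_graph m) ?K"
    using inj by (auto simp: graph_iso_def cycle_graph_def bij_betw_def)
  ultimately show ?thesis
    unfolding contains_graph_def by blast
qed

lemma contains_cycleE:
  assumes "contains_graph G (cycle_graph m)"
  obtains f where "\<And>i. i < m \<Longrightarrow> (f i, f (Suc i mod m)) \<in> adj G"
proof -
  from assms obtain K f where K: "edges K \<subseteq> edges G"
    and e: "edges K = (\<lambda>e. f ` e) ` edges (cycle_graph m)"
    by (auto simp: contains_graph_def graph_iso_def is_subgraph_def)
  have "(f i, f (Suc i mod m)) \<in> adj G" if "i < m" for i
  proof -
    have "f ` {i, Suc i mod m} \<in> edges K"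
      unfolding e by (rule imageI) (use that in \<open>auto simp: cycle_graph_def\<close>)
    with K show ?thesis by (auto simp: adj_def)
  qed
  then show thesis by (rule that)
qed

section \<open>Homomorphisms to an odd cycle\<close>

text \<open>Modulo \<open>M\<close> the label \<open>h\<close> changes by 1 or -1 along each edge.
  Around the cycle these \<open>m\<close> steps sum to an odd number, hence to a nonzero multiple of
  \<open>M\<close> of absolute value at most \<open>m\<close>.\<close>

lemma odd_cycle_length_ge:
  fixes h :: "'a \<Rightarrow> int" and M :: nat
  assumes hom: "\<And>x y. (x, y) \<in> adj G \<Longrightarrow> int M dvd h y - h x - 1 \<or> int M dvd h y - h x + 1"
    and m: "odd m" and cyc: "contains_graph G (cycle_graph m)"
  shows "M \<le> m"
proof -
  obtain f where f: "\<And>i. i < m \<Longrightarrow> (f i, f (Suc i mod m)) \<in> adj G"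
    using contains_cycleE[OF cyc] by blast
  \<comment> \<open>Reducing the index modulo \<open>m\<close> gives \<open>g m = g 0\<close>, so
    the differences of \<open>g\<close> telescope to 0.\<close>
  define g where "g i = h (f (i mod m))" for i
  have "\<exists>e\<in>{1, -1}. int M dvd g (Suc i) - g i - e" if "i < m" for i
    using hom[OF f[OF that]] that by (auto simp: g_def)
  then obtain e where e: "\<And>i. i < m \<Longrightarrow> e i \<in> {1, -1 :: int} \<and> int M dvd g (Suc i) - g i - e i"
    by metis
  have "int M dvd (\<Sum>i<m. g (Suc i) - g i - e i)"
    using e by (intro dvd_sum) auto
  also have "(\<Sum>i<m. g (Suc i) - g i - e i) = - (\<Sum>i<m. e i)"
    by (simp only: sum_subtractf[of _ e] sum_lessThan_telescope) (simp add: g_def)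
  finally have dvd: "int M dvd (\<Sum>i<m. e i)" by simp
  have "odd (\<Sum>i<m. e i) \<longleftrightarrow> odd (card {i \<in> {..<m}. odd (e i)})"
    by (simp add: even_sum_iff)
  also have "{i \<in> {..<m}. odd (e i)} = {..<m}" using e by fastforce
  finally have "odd (\<Sum>i<m. e i)" using m by simp
  then have "(\<Sum>i<m. e i) \<noteq> 0" by (metis even_zero)
  with dvd have "int M \<le> \<bar>\<Sum>i<m. e i\<bar>"
    by (metis abs_of_nat dvd_imp_le_int)
  also have "\<dots> \<le> (\<Sum>i<m. \<bar>e i\<bar>)" by (rule sum_abs)
  also have "\<dots> \<le> (\<Sum>i<m. 1)" using e by (intro sum_mono) fastforce
  finally show ?thesis by simp
qed

text \<open>Lets a construction use any vertex type: the injection \<open>c\<close> moves it to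
  \<open>nat\<close>. The label \<open>h\<close> is a homomorphism to the cycle of length
  \<open>2 * l + 1\<close>, which excludes shorter odd cycles.\<close>

lemma graph_of_relation:
  fixes V :: "'a set" and R :: "'a \<Rightarrow> 'a \<Rightarrow> bool" and h :: "'a \<Rightarrow> int"
  assumes fin: "finite V" and l: "l \<ge> 1" and sym: "\<And>x y. R x y \<Longrightarrow> R y x"
    and deg: "\<And>x. x \<in> V \<Longrightarrow> card {y \<in> V. R x y} = k"
    and hom: "\<And>x y. x \<in> V \<Longrightarrow> y \<in> V \<Longrightarrow> R x y \<Longrightarrow>
      int (2 * l + 1) dvd h y - h x - 1 \<or> int (2 * l + 1) dvd h y - h x + 1"
  shows "\<exists>G :: nat graph. simple_graph G \<and> card (verts G) = card V \<and>
     regular_graph k G \<and> (\<forall>H\<in>odd_cycles l. \<not> contains_graph G H)"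
proof -
  obtain c :: "'a \<Rightarrow> nat" where c: "inj_on c V"
    using finite_imp_inj_to_nat_seg[OF fin] by blast
  define G where "G = (c ` V, {{c x, c y} | x y. x \<in> V \<and> y \<in> V \<and> R x y})"
  \<comment> \<open>A loop would make \<open>2 * l + 1\<close>, which is at least 3, divide 1 or
    -1.\<close>
  have irr: "\<not> R x x" if "x \<in> V" for x
    using hom[OF that that] l by (auto simp flip: of_nat_Suc of_nat_mult)
  have G: "simple_graph G"
    unfolding simple_graph_def
  proof (intro conjI ballI)
    fix e assume "e \<in> edges G"
    then obtain x y where e: "e = {c x, c y}" "x \<in> V" "y \<in> V" "R x y" by (auto simp: G_def)
    moreover from e irr have "x \<noteq> y" by auto
    ultimately show "e \<subseteq> verts G" "card e = 2"
      using c by (auto simp: G_def inj_on_def card_2_iff)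
  qed (simp add: G_def fin)
  have adj: "adj G = {(c x, c y) | x y. x \<in> V \<and> y \<in> V \<and> R x y}"
    using sym by (fastforce simp: adj_def G_def doubleton_eq_iff)
  have "adj G `` {c x} = c ` {y \<in> V. R x y}" if "x \<in> V" for x
    using c that by (auto simp: adj inj_on_def)
  moreover have "card (c ` {y \<in> V. R x y}) = k" if "x \<in> V" for x
    using deg[OF that] c by (subst card_image) (auto intro: inj_on_subset)
  ultimately have "regular_graph k G"
    by (auto simp: regular_graph_def vdegree_eq_card_adj[OF G]) (auto simp: G_def)
  moreover have "\<not> contains_graph G H" if H: "H \<in> odd_cycles l" for H
  proof
    assume "contains_graph G H"
    moreover from H obtain m where m: "H = cycle_graph m" "odd m" "m \<le> 2 * l - 1"
      by (auto simp: odd_cycles_def)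
    moreover have "int (2 * l + 1) dvd h (inv_into V c y) - h (inv_into V c x) - 1 \<or>
        int (2 * l + 1) dvd h (inv_into V c y) - h (inv_into V c x) + 1" if "(x, y) \<in> adj G" for x y
    proof -
      from that obtain a b where "x = c a" "y = c b" "a \<in> V" "b \<in> V" "R a b"
        by (auto simp: adj)
      with hom[of a b] c show ?thesis by (simp only: inv_into_f_f)
    qed
    ultimately have "2 * l + 1 \<le> m"
      by (intro odd_cycle_length_ge[where G = G and h = "\<lambda>x. h (inv_into V c x)"]) auto
    with m show False by simp
  qed
  ultimately show ?thesis
    using G c by (intro exI[of _ G]) (auto simp: G_def card_image)
qed

section \<open>The maximum, and the bound for triangle-free graphs\<close>

text \<open>The uniform bound also makes the set of degrees finite, so that \<open>Max\<close> is a
  genuine maximum.\<close>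

lemma ex_r_eqI:
  assumes "\<exists>G :: nat graph. simple_graph G \<and> card (verts G) = n \<and>
     regular_graph K G \<and> (\<forall>H\<in>\<H>. \<not> contains_graph G H)"
    and "\<And>k (G :: nat graph). \<lbrakk>simple_graph G; card (verts G) = n; regular_graph k G;
      \<And>H. H \<in> \<H> \<Longrightarrow> \<not> contains_graph G H\<rbrakk> \<Longrightarrow> k \<le> K"
  shows "ex_r n \<H> = K"
  unfolding ex_r_def
proof (rule Max_eqI)
  show "finite {k. \<exists>G :: nat graph. simple_graph G \<and> card (verts G) = n \<and>
     regular_graph k G \<and> (\<forall>H\<in>\<H>. \<not> contains_graph G H)}"
    by (rule finite_subset[of _ "{..K}"]) (use assms(2) in auto)
qed (use assms in auto)

lemma triangle_free_regular_le:
  assumes G: "simple_graph G" and reg: "regular_graph k G" and ne: "verts G \<noteq> {}"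
    and tri: "\<not> contains_graph G (cycle_graph 3)"
  shows "2 * k \<le> card (verts G)"
proof (cases "k = 0")
  case False
  have fin: "finite (verts G)" using G by (simp add: simple_graph_def)
  have deg: "card (adj G `` {v}) = k" if "v \<in> verts G" for v
    using reg that by (simp add: regular_graph_def vdegree_eq_card_adj[OF G])
  from ne obtain u where u: "u \<in> verts G" by auto
  from deg[OF u] False obtain v where uv: "(u, v) \<in> adj G"
    by (metis Image_singleton_iff card.empty ex_in_conv)
  have "adj G `` {u} \<inter> adj G `` {v} = {}"
  proof (rule ccontr)
    assume "adj G `` {u} \<inter> adj G `` {v} \<noteq> {}"
    then obtain w where w: "(u, w) \<in> adj G" "(v, w) \<in> adj G" by auto
    have "contains_graph G (cycle_graph 3)"
    proof (rule contains_cycleI[OF G, of "\<lambda>i. if i = 0 then u else if i = 1 then v else w"])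
      show "inj_on (\<lambda>i. if i = 0 then u else if i = 1 then v else w) {..<3::nat}"
        using uv w adj_irrefl[OF G] by (auto simp: inj_on_def)
    next
      fix i :: nat assume "i < 3"
      then consider "i = 0" | "i = 1" | "i = 2" by linarith
      then show "(if i = 0 then u else if i = 1 then v else w,
        if Suc i mod 3 = 0 then u else if Suc i mod 3 = 1 then v else w) \<in> adj G"
        using uv w sym_adj[of G] by cases (auto dest: symD)
    qed
    with tri show False by simp
  qed
  moreover have "adj G `` {u} \<subseteq> verts G" "adj G `` {v} \<subseteq> verts G"
    using adj_subset[OF G] by auto
  ultimately have "card (adj G `` {u}) + card (adj G `` {v}) \<le> card (verts G)"
    using fin by (metis Un_least card_Un_disjoint card_mono finite_subset)
  with deg u uv adj_subset[OF G] show ?thesis by fastforce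
qed simp

section \<open>Upper bound for odd order\<close>

text \<open>Handshake argument: counting incidences of vertices and edges in two ways gives
  \<open>card (verts G) * k = 2 * card (edges G)\<close>.\<close>

lemma even_degree_of_odd_order:
  assumes G: "simple_graph G" and reg: "regular_graph k G" and odd: "odd (card (verts G))"
  shows "even k"
proof -
  have fin: "finite (verts G)" using G by (simp add: simple_graph_def)
  then have finE: "finite (edges G)"
    by (rule_tac finite_subset[of _ "Pow (verts G)"]) (use G in \<open>auto simp: simple_graph_def\<close>)
  have "card {v \<in> verts G. v \<in> e} = 2" if "e \<in> edges G" for e
  proof -
    have "{v \<in> verts G. v \<in> e} = e" using G that by (auto simp: simple_graph_def)
    with G that show ?thesis by (auto simp: simple_graph_def)
  qed
  then have "(\<Sum>v\<in>verts G. card {e \<in> edges G. v \<in> e}) = 2 * card (edges G)"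
    by (intro sum_multicount) (use fin finE in auto)
  then have "card (verts G) * k = 2 * card (edges G)"
    using reg by (simp add: regular_graph_def vdegree_def)
  with odd show ?thesis by (metis dvd_triv_left even_mult_iff)
qed

lemma relpow_sym:
  assumes "sym R" "(x, y) \<in> R ^^ m"
  shows "(y, x) \<in> R ^^ m"
  using assms(2)
proof (induction m arbitrary: y)
  case (Suc m)
  then obtain z where "(x, z) \<in> R ^^ m" "(z, y) \<in> R" by auto
  with Suc.IH assms(1) show ?case by (metis relpow_Suc_I2 symD)
qed simp

text \<open>Without odd closed walks, the parity of walks from a representative of each component
  defines a bipartition. Regularity of positive degree makes its two sides equally large, so the
  order is even.\<close>

lemma odd_closed_walk_exists:
  fixes R :: "'a rel"
  assumes fin: "finite V" and RV: "R \<subseteq> V \<times> V" and sym: "sym R"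
    and deg: "\<And>v. v \<in> V \<Longrightarrow> card (R `` {v}) = k" and k: "k > 0" and odd: "odd (card V)"
  shows "\<exists>m x. odd m \<and> (x, x) \<in> R ^^ m"
proof (rule ccontr)
  assume "\<not> ?thesis"
  then have no: "\<And>m x. (x, x) \<in> R ^^ m \<Longrightarrow> even m" by blast
  \<comment> \<open>The choice depends only on the set of vertices reachable from \<open>v\<close>,
    hence is constant on components.\<close>
  define rep where "rep v = (SOME w. (v, w) \<in> R\<^sup>*)" for v
  have rep: "\<exists>m. (rep v, v) \<in> R ^^ m" for v
  proof -
    have "(v, rep v) \<in> R\<^sup>*" unfolding rep_def by (rule someI[of _ v]) simp
    with relpow_sym[OF sym] show ?thesis by (meson rtrancl_imp_relpow)
  qed
  have rep_eq: "rep u = rep v" if "(u, v) \<in> R" for u v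
  proof -
    have "(v, u) \<in> R" using that sym by (auto dest: symD)
    with that have "(u, w) \<in> R\<^sup>* \<longleftrightarrow> (v, w) \<in> R\<^sup>*" for w
      by (meson converse_rtrancl_into_rtrancl)
    then show ?thesis by (simp add: rep_def)
  qed
  define X where "X = {v \<in> V. \<exists>m. even m \<and> (rep v, v) \<in> R ^^ m}"
  have X: "u \<in> X \<longleftrightarrow> v \<notin> X" if uv: "(u, v) \<in> R" for u v
  proof -
    obtain a where a: "(rep u, u) \<in> R ^^ a" using rep by blast
    have step: "(rep v, v) \<in> R ^^ Suc b" if "(rep u, u) \<in> R ^^ b" for b
      using that uv rep_eq[OF uv] by auto
    \<comment> \<open>Going along one walk and back along the other is a closed walk of length
      \<open>b + c\<close>, which is even.\<close>
    have same: "even b \<longleftrightarrow> even c" if "(rep w, w) \<in> R ^^ b" "(rep w, w) \<in> R ^^ c" for w b c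
    proof -
      have "(rep w, rep w) \<in> R ^^ (b + c)"
        using that relpow_sym[OF sym] by (metis relpow_trans)
      with no show ?thesis by (metis even_add)
    qed
    have "u \<in> V" "v \<in> V" using uv RV by auto
    then have "u \<in> X \<longleftrightarrow> even a" "v \<in> X \<longleftrightarrow> even (Suc a)"
      unfolding X_def using a step[OF a] same by blast+
    then show ?thesis by simp
  qed
  have fX: "finite X" "X \<subseteq> V" using fin by (auto simp: X_def)
  have Rf: "finite (R `` {v})" for v
    using RV by (intro finite_subset[OF _ fin]) auto
  \<comment> \<open>Every edge joins \<open>X\<close> to \<open>V - X\<close>; counting the edges
    from either side gives \<open>card X * k = card (V - X) * k\<close>.\<close>
  have "prod.swap ` (SIGMA x:X. R `` {x}) = (SIGMA y:V - X. R `` {y})"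
  proof (intro equalityI subsetI)
    fix z assume "z \<in> (SIGMA y:V - X. R `` {y})"
    then obtain y x where "z = prod.swap (x, y)" "y \<in> V - X" "(x, y) \<in> R"
      using sym by (auto dest: symD)
    moreover from this have "x \<in> X" using X by auto
    ultimately show "z \<in> prod.swap ` (SIGMA x:X. R `` {x})" by blast
  qed (use X RV sym in \<open>auto dest: symD\<close>)
  then have "card (SIGMA x:X. R `` {x}) = card (SIGMA y:V - X. R `` {y})"
    by (metis card_image inj_swap)
  moreover have "card (SIGMA x:Y. R `` {x}) = card Y * k" if "Y \<subseteq> V" for Y
    using that fin deg Rf by (subst card_SigmaI) (auto intro: finite_subset simp: subset_iff)
  ultimately have "card X = card (V - X)" using fX k by auto
  then have "card V = 2 * card X"
    using fX fin by (metis card_Diff_subset card_mono le_add_diff_inverse mult_2)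
  with odd show False by simp
qed

lemma odd_girth_degree_bound:
  assumes G: "simple_graph G" and reg: "regular_graph k G" and odd: "odd (card (verts G))"
    and l: "l \<ge> 2" and free: "\<And>H. H \<in> odd_cycles l \<Longrightarrow> \<not> contains_graph G H"
  shows "(2 * l + 1) * k \<le> 2 * card (verts G)"
proof (cases "k = 0")
  case False
  let ?R = "adj G"
  have fin: "finite (verts G)" using G by (simp add: simple_graph_def)
  have deg: "card (?R `` {v}) = k" if "v \<in> verts G" for v
    using reg that by (simp add: regular_graph_def vdegree_eq_card_adj[OF G])
  (* Closed walks in place of cycles: a shortest odd closed walk is automatically a cycle, and
     shortcuts through an arbitrary vertex, on the cycle or not, give walks directly. *)
  define P where "P m \<longleftrightarrow> odd m \<and> (\<exists>x. (x, x) \<in> ?R ^^ m)" for m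
  define m where "m = (LEAST m. P m)"
  have "\<exists>m. P m"
    using odd_closed_walk_exists[OF fin adj_subset[OF G] sym_adj deg _ odd] False
    by (auto simp: P_def)
  then have "P m" unfolding m_def by (rule LeastI_ex)
  have least: "m \<le> b" if "odd b" "(x, x) \<in> ?R ^^ b" for b x
    unfolding m_def by (rule Least_le) (use that in \<open>auto simp: P_def\<close>)
  from \<open>P m\<close> obtain f where m: "odd m" and f0: "f m = f 0"
    and f: "\<And>i. i < m \<Longrightarrow> (f i, f (Suc i)) \<in> ?R"
    unfolding P_def relpow_fun_conv by metis
  have walk: "(f i, f j) \<in> ?R ^^ (j - i)" if "i \<le> j" "j \<le> m" for i j
    unfolding relpow_fun_conv
    by (rule exI[of _ "\<lambda>a. f (i + a)"]) (use that f in auto)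
  \<comment> \<open>The complementary arc, from \<open>f j\<close> through \<open>f m = f 0\<close>
    to \<open>f i\<close>.\<close>
  have wrap: "(f j, f i) \<in> ?R ^^ (m - (j - i))" if "i \<le> j" "j \<le> m" for i j
  proof -
    have "(f j, f i) \<in> ?R ^^ ((m - j) + (i - 0))"
      by (rule relpow_trans[of _ "f 0"]) (use walk[of j m] walk[of 0 i] that f0 in auto)
    with that show ?thesis by (simp add: algebra_simps)
  qed
  \<comment> \<open>A repeated vertex splits the closed walk into two shorter closed walks, one of
    them odd.\<close>
  have inj: "inj_on f {..<m}"
  proof (rule linorder_inj_onI)
    fix i j assume ij: "i < j" "i \<in> {..<m}" "j \<in> {..<m}"
    show "f i \<noteq> f j"
    proof
      assume eq: "f i = f j"
      have "(f i, f i) \<in> ?R ^^ (j - i)" "(f i, f i) \<in> ?R ^^ (m - (j - i))"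
        using walk[of i j] wrap[of i j] ij eq by auto
      moreover have "odd (j - i) \<or> odd (m - (j - i))" using m ij by auto
      ultimately have "m \<le> j - i \<or> m \<le> m - (j - i)" using least by blast
      with ij show False by auto
    qed
  qed auto
  have "m \<noteq> 1" using f[of 0] f0 adj_irrefl[OF G] by auto
  with m have "m \<ge> 3" by (cases m rule: nat.exhaust) (auto elim!: oddE)
  have "contains_graph G (cycle_graph m)"
  proof (rule contains_cycleI[OF G inj])
    fix i assume "i < m"
    with f[of i] f0 show "(f i, f (Suc i mod m)) \<in> ?R"
      by (cases "Suc i = m") auto
  qed
  with free have "cycle_graph m \<notin> odd_cycles l" by blast
  with \<open>m \<ge> 3\<close> m have "m > 2 * l - 1" by (auto simp: odd_cycles_def)
  with m l have ml: "m \<ge> 2 * l + 1" by (auto elim!: oddE)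
  \<comment> \<open>Three neighbours of \<open>v\<close> cut the cycle into arcs with
    \<open>a + b + c = m\<close>, one of them odd. Closing an odd arc through \<open>v\<close> adds
    2 to its length, so by minimality the other two arcs have length 1. These are odd too, and the
    same argument applied to one of them gives \<open>m \<le> 3\<close>.\<close>
  have two: "card {i \<in> {..<m}. (v, f i) \<in> ?R} \<le> 2" for v
  proof (rule ccontr)
    assume "\<not> ?thesis"
    then have "3 \<le> card {i \<in> {..<m}. (v, f i) \<in> ?R}" by simp
    then obtain T where T: "T \<subseteq> {i \<in> {..<m}. (v, f i) \<in> ?R}" "card T = 3"
      by (meson obtain_subset_with_card_n)
    then obtain x y z where xyz: "T = {x, y, z}" "x \<noteq> y" "y \<noteq> z" "x \<noteq> z"
      by (auto simp: card_3_iff)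
    obtain i j k where ijk: "i \<in> T" "j \<in> T" "k \<in> T" "i < j" "j < k"
      using xyz by (metis insertCI linorder_neqE_nat)
    have N: "(v, f i) \<in> ?R" "(v, f j) \<in> ?R" "(v, f k) \<in> ?R" "k < m"
      using T ijk by auto
    have close: "m \<le> b + 2" if "(f a, f c) \<in> ?R ^^ b" "(v, f a) \<in> ?R" "(v, f c) \<in> ?R" "odd b" for a b c
    proof -
      have "(v, v) \<in> ?R ^^ Suc (Suc b)"
        using that sym_adj[of G] by (meson relpow_Suc_I relpow_Suc_I2 symD)
      from least[OF _ this] that(4) show ?thesis by simp
    qed
    define a b c where abc: "a = j - i" "b = k - j" "c = m - (k - i)"
    have "odd a \<Longrightarrow> m \<le> a + 2" "odd b \<Longrightarrow> m \<le> b + 2" "odd c \<Longrightarrow> m \<le> c + 2"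
      using close[OF walk[of i j]] close[OF walk[of j k]] close[OF wrap[of i k]] N ijk
      by (auto simp: abc)
    moreover have sum: "a + b + c = m" "a \<ge> 1" "b \<ge> 1" "c \<ge> 1"
      using ijk N by (auto simp: abc)
    moreover from sum m have "odd a \<or> odd b \<or> odd c" by auto
    moreover have "m \<ge> 5" using ml l by simp
    moreover have "b = 1 \<and> c = 1" if "m \<le> a + 2" using that sum by linarith
    moreover have "a = 1 \<and> c = 1" if "m \<le> b + 2" using that sum by linarith
    moreover have "a = 1 \<and> b = 1" if "m \<le> c + 2" using that sum by linarith
    ultimately show False by fastforce
  qed
  have fV: "f i \<in> verts G" if "i < m" for i
    using f[OF that] adj_subset[OF G] by auto
  \<comment> \<open>Double counting of adjacent pairs of a cycle position and a vertex.\<close>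
  have "m * k = (\<Sum>i<m. card {v \<in> verts G. (v, f i) \<in> ?R})"
  proof -
    have "{v \<in> verts G. (v, f i) \<in> ?R} = ?R `` {f i}" for i
      using adj_subset[OF G] sym_adj[of G] by (auto dest: symD)
    with deg fV show ?thesis by simp
  qed
  also have "\<dots> = (\<Sum>v\<in>verts G. card {i \<in> {..<m}. (v, f i) \<in> ?R})"
    by (rule sum_multicount_gen[symmetric, OF fin]) auto
  also have "\<dots> \<le> (\<Sum>v\<in>verts G. 2)" by (rule sum_mono) (rule two)
  finally have "m * k \<le> 2 * card (verts G)" by simp
  with ml show ?thesis by (meson le_trans mult_le_mono1)
qed simp

lemma odd_order_degree_le:
  assumes G: "simple_graph G" and reg: "regular_graph k G" and odd: "odd (card (verts G))"
    and l: "l \<ge> 2" and free: "\<And>H. H \<in> odd_cycles l \<Longrightarrow> \<not> contains_graph G H"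
  shows "k \<le> 2 * (card (verts G) div (2 * l + 1))"
proof -
  \<comment> \<open>Halving the even degree before dividing puts the floor inside the factor
    2.\<close>
  obtain j where j: "k = 2 * j"
    using even_degree_of_odd_order[OF G reg odd] by (elim evenE)
  have "j * (2 * l + 1) \<le> card (verts G)"
    using odd_girth_degree_bound[OF G reg odd l free] by (simp add: j algebra_simps)
  then have "j \<le> card (verts G) div (2 * l + 1)"
    by (simp add: less_eq_div_iff_mult_less_eq)
  with j show ?thesis by simp
qed

section \<open>Construction for odd order\<close>

text \<open>The condition \<open>(i + j) mod m < q\<close> defines a circulant
  \<open>q\<close>-regular bipartite graph between two copies of \<open>{..<m}\<close>, since
  \<open>j\<close> is sent to \<open>(i + j) mod m\<close> by a permutation.\<close>

lemma card_rotate_less: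
  fixes i m q :: nat
  assumes "q \<le> m"
  shows "card {j \<in> {..<m}. (i + j) mod m < q} = q"
proof (cases "m = 0")
  case False
  let ?g = "\<lambda>j. (i + j) mod m"
  have inj: "inj_on ?g {..<m}"
  proof (rule linorder_inj_onI)
    fix x y assume xy: "x < y" "x \<in> {..<m}" "y \<in> {..<m}"
    show "(i + x) mod m \<noteq> (i + y) mod m"
    proof
      assume "(i + x) mod m = (i + y) mod m"
      then have "m dvd (i + y) - (i + x)"
        using xy by (metis add_left_mono less_imp_le mod_eq_dvd_iff_nat)
      with xy show False by (auto dest: dvd_imp_le)
    qed
  qed auto
  moreover have "?g ` {..<m} \<subseteq> {..<m}" using False by auto
  ultimately have im: "?g ` {..<m} = {..<m}"
    by (simp add: endo_inj_surj)
  have "?g ` {j \<in> {..<m}. ?g j < q} = {..<q}"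
  proof (intro equalityI subsetI)
    fix x assume "x \<in> {..<q}"
    moreover with assms im have "x \<in> ?g ` {..<m}" by auto
    ultimately show "x \<in> ?g ` {j \<in> {..<m}. ?g j < q}" by auto
  qed auto
  then show ?thesis
    using inj by (metis (no_types, lifting) card_image card_lessThan inj_on_subset mem_Collect_eq subsetI)
qed (use assms in simp)

text \<open>Counts the neighbours left after removing the circulant graph, when the opposite part
  has \<open>b\<close> further vertices that the removal does not touch.\<close>

lemma card_rotate_ge:
  fixes x m b q :: nat
  assumes "q \<le> m"
  shows "card {y \<in> {..<m + b}. \<not> (y < m \<and> (x + y) mod m < q)} = m + b - q"
proof -
  have "{y \<in> {..<m + b}. \<not> (y < m \<and> (x + y) mod m < q)} =
      {..<m + b} - {y \<in> {..<m}. (x + y) mod m < q}"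
    by auto
  also have "card \<dots> = card {..<m + b} - card {y \<in> {..<m}. (x + y) mod m < q}"
    by (rule card_Diff_subset) auto
  finally show ?thesis using card_rotate_less[OF assms] by simp
qed

lemma card_two_fibres:
  assumes "a \<noteq> b" "finite A" "finite B"
  shows "card ({a} \<times> A \<union> {b} \<times> B) = card A + card B"
  using assms by (subst card_Un_disjoint) (auto simp: card_cartesian_product)

text \<open>
  Part \<open>i\<close> has \<open>s i\<close> vertices for \<open>2 \<le> i \<le> 2l\<close>. Part 0 consists of \<open>s (2l)\<close> vertices followed by \<open>p\<close>
  extra ones, part 1 of \<open>s 2\<close> vertices followed by \<open>q\<close> extra ones. Removed from the complete blow-up
  are all edges between the two sets of extra vertices, a \<open>q\<close>-regular bipartite graph between part \<open>2l\<close>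
  and the non-extra vertices of part 0, and a \<open>p\<close>-regular one between part 2 and the non-extra
  vertices of part 1.
\<close>

lemma blowup_graph_exists:
  fixes s :: "nat \<Rightarrow> nat"
  assumes l: "l \<ge> 2" and p: "p \<le> s 2" and q: "q \<le> s (2 * l)"
    and s01: "s 2 + s (2 * l) = 2 * t"
    and s2: "s 2 + q + s 3 = 2 * t + p"
    and s2l: "s (2 * l) + p + s (2 * l - 1) = 2 * t + q"
    and s_step: "\<And>i. 2 \<le> i \<Longrightarrow> i + 2 \<le> 2 * l \<Longrightarrow> s i + s (i + 2) = 2 * t"
    and n: "n = s (2 * l) + p + (s 2 + q) + (\<Sum>i = 2..2 * l. s i)"
  shows "\<exists>G :: nat graph. simple_graph G \<and> card (verts G) = n \<and>
     regular_graph (2 * t) G \<and> (\<forall>H\<in>odd_cycles l. \<not> contains_graph G H)"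
proof -
  define N where "N i = (if i = 0 then s (2 * l) + p else if i = 1 then s 2 + q else s i)" for i
  define V where "V = (SIGMA i:{..2 * l}. {..<N i})"
  \<comment> \<open>Edges lead from a part to the cyclically next one; \<open>R\<close> symmetrises.
    The clause \<open>j = Suc i\<close> gives nothing in \<open>V\<close> for
    \<open>i = 2 * l\<close>.\<close>
  define E where "E = (\<lambda>(i, x) (j, y).
    i = 0 \<and> j = 1 \<and> (x < s (2 * l) \<or> y < s 2) \<or>
    i = 1 \<and> j = 2 \<and> \<not> (x < s 2 \<and> (x + y) mod s 2 < p) \<or>
    2 \<le> i \<and> j = Suc i \<or>
    i = 2 * l \<and> j = 0 \<and> \<not> (y < s (2 * l) \<and> (x + y) mod s (2 * l) < q))"
  define R where "R u v \<longleftrightarrow> E u v \<or> E v u" for u v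
  have "card V = (\<Sum>i\<in>{..2 * l}. N i)" by (simp add: V_def)
  also have "{..2 * l} = insert 0 (insert 1 {2..2 * l})" using l by auto
  also have "(\<Sum>i\<in>insert 0 (insert 1 {2..2 * l}). N i) = N 0 + (N 1 + (\<Sum>i = 2..2 * l. N i))"
    by simp
  also have "(\<Sum>i = 2..2 * l. N i) = (\<Sum>i = 2..2 * l. s i)"
    by (rule sum.cong) (auto simp: N_def)
  finally have card: "card V = n" by (simp add: n N_def)
  have deg: "card {v \<in> V. R (i, x) v} = 2 * t" if "(i, x) \<in> V" for i x
  proof -
    from that have i: "i \<le> 2 * l" and x: "x < N i" by (auto simp: V_def)
    from i consider "i = 0" | "i = 1" | "i = 2" | "3 \<le> i" "i < 2 * l" | "i = 2 * l"
      by linarith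
    then show ?thesis
    proof cases
      case 1
      have "{v \<in> V. R (i, x) v} =
          {1} \<times> {y \<in> {..<s 2 + q}. x < s (2 * l) \<or> y < s 2} \<union>
          {2 * l} \<times> {y \<in> {..<s (2 * l)}. \<not> (x < s (2 * l) \<and> (x + y) mod s (2 * l) < q)}"
        using 1 l by (auto simp: V_def R_def E_def N_def add.commute)
      also have "card \<dots> = 2 * t"
      \<comment> \<open>A non-extra vertex trades \<open>q\<close> neighbours in part
        \<open>2 * l\<close> for the \<open>q\<close> extra vertices of part 1, so both kinds have
        degree \<open>s 2 + s (2 * l)\<close>. Part 1 is symmetric.\<close>
      proof (cases "x < s (2 * l)")
        case True
        then show ?thesis
          using l q s01 card_rotate_ge[OF q, of 0 x] by (subst card_two_fibres) (auto cong: conj_cong)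
      next
        case False
        then have "{y \<in> {..<s 2 + q}. x < s (2 * l) \<or> y < s 2} = {..<s 2}" by auto
        with False show ?thesis
          using l s01 by (subst card_two_fibres) auto
      qed
      finally show ?thesis .
    next
      case 2
      have "{v \<in> V. R (i, x) v} =
          {0} \<times> {y \<in> {..<s (2 * l) + p}. y < s (2 * l) \<or> x < s 2} \<union>
          {2} \<times> {y \<in> {..<s 2}. \<not> (x < s 2 \<and> (x + y) mod s 2 < p)}"
        using 2 l by (auto simp: V_def R_def E_def N_def add.commute)
      also have "card \<dots> = 2 * t"
      proof (cases "x < s 2")
        case True
        then show ?thesis
          using l p s01 card_rotate_ge[OF p, of 0 x] by (subst card_two_fibres) (auto cong: conj_cong)
      next
        case False
        then have "{y \<in> {..<s (2 * l) + p}. y < s (2 * l) \<or> x < s 2} = {..<s (2 * l)}" by auto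
        with False show ?thesis
          using l s01 by (subst card_two_fibres) auto
      qed
      finally show ?thesis .
    next
      case 3
      have "{v \<in> V. R (i, x) v} =
          {1} \<times> {y \<in> {..<s 2 + q}. \<not> (y < s 2 \<and> (x + y) mod s 2 < p)} \<union> {3} \<times> {..<s 3}"
        using 3 l by (auto simp: V_def R_def E_def N_def add.commute)
      \<comment> \<open>The degree is \<open>s 2 + q - p + s 3\<close>, which \<open>s2\<close>
        equates to \<open>2 * t\<close>; \<open>s2l\<close> does the same for part
        \<open>2 * l\<close>.\<close>
      then show ?thesis
        using s2 p card_rotate_ge[OF p, of q x] by (simp add: card_two_fibres)
    next
      case 4
      have "{v \<in> V. R (i, x) v} = {i - 1} \<times> {..<s (i - 1)} \<union> {i + 1} \<times> {..<s (i + 1)}"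
        using 4 by (auto simp: V_def R_def E_def N_def)
      then show ?thesis
        using s_step[of "i - 1"] 4 by (simp add: card_two_fibres)
    next
      case 5
      have "{v \<in> V. R (i, x) v} =
          {0} \<times> {y \<in> {..<s (2 * l) + p}. \<not> (y < s (2 * l) \<and> (x + y) mod s (2 * l) < q)} \<union>
          {2 * l - 1} \<times> {..<s (2 * l - 1)}"
        using 5 l by (auto simp: V_def R_def E_def N_def add.commute)
      then show ?thesis
        using s2l q l card_rotate_ge[OF q, of p x] by (simp add: card_two_fibres)
    qed
  qed
  have "\<exists>G :: nat graph. simple_graph G \<and> card (verts G) = card V \<and>
     regular_graph (2 * t) G \<and> (\<forall>H\<in>odd_cycles l. \<not> contains_graph G H)"
  proof (rule graph_of_relation[where R = R and h = "\<lambda>v. int (fst v)"])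
    fix u v assume "u \<in> V" "v \<in> V" "R u v"
    have E: "int (2 * l + 1) dvd int (fst v) - int (fst u) - 1" if "E u v" for u v
    proof -
      from that have "fst v = Suc (fst u) \<or> fst u = 2 * l \<and> fst v = 0"
        by (auto simp: E_def split: prod.splits)
      then show ?thesis
      proof
        assume "fst u = 2 * l \<and> fst v = 0"
        then have "int (fst v) - int (fst u) - 1 = - int (2 * l + 1)" by simp
        then show ?thesis by (metis dvd_minus_iff dvd_refl)
      qed simp
    qed
    from \<open>R u v\<close> consider "E u v" | "E v u" by (auto simp: R_def)
    then show "int (2 * l + 1) dvd int (fst v) - int (fst u) - 1 \<or>
        int (2 * l + 1) dvd int (fst v) - int (fst u) + 1"
    proof cases
      case 2
      have "int (fst v) - int (fst u) + 1 = - (int (fst u) - int (fst v) - 1)" by simp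
      then show ?thesis using E[OF 2] by (metis dvd_minus_iff)
    qed (use E in blast)
  qed (use l deg in \<open>auto simp: V_def R_def\<close>)
  with card show ?thesis by simp
qed

text \<open>The remainder modulo \<open>2 * l + 1\<close> is spread over parts 0 and 1 as
  \<open>p + q\<close> extra vertices. The bound on \<open>t\<close> leaves room for the regular
  bipartite graphs to be removed.\<close>

lemma odd_order_graph_exists:
  fixes n l :: nat
  defines "t \<equiv> n div (2 * l + 1)"
  assumes l: "l \<ge> 2" and t: "t \<ge> l + 1"
  shows "\<exists>G :: nat graph. simple_graph G \<and> card (verts G) = n \<and>
     regular_graph (2 * t) G \<and> (\<forall>H\<in>odd_cycles l. \<not> contains_graph G H)"
proof -
  define r where "r = n mod (2 * l + 1)"
  have n: "n = (2 * l + 1) * t + r" by (simp only: t_def r_def mult_div_mod_eq)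
  have r: "r \<le> 2 * l" unfolding r_def using mod_less_divisor[of "2 * l + 1" n] by linarith
  show ?thesis
  proof (cases "even r")
    case True
    then obtain p where p: "r = 2 * p" by (elim evenE)
    show ?thesis
      by (rule blowup_graph_exists[where s = "\<lambda>_. t" and p = p and q = p])
        (use l t r in \<open>auto simp: n p algebra_simps Suc_diff_le\<close>)
  next
    case False
    then obtain p where p: "r = 2 * p + 1" by (elim oddE)
    (* With q = p + 1 the degree equations force the sizes: t - 1, t, t + 1, t repeats with period 4,
       reaching t - 1 at part 2 if l is even and at part 3 if l is odd. *)
    define c :: nat where "c = (if even l then 2 else 1)"
    define g where "g a = (if a mod 4 = 0 then t - 1 else if a mod 4 = 2 then t + 1 else t)" for a :: nat
    define s where "s i = g (i + c)" for i
    have g: "g a + g b = 2 * t" if "(a + b) mod 4 = 2" for a b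
    proof -
      have "a mod 4 = 0 \<and> b mod 4 = 2 \<or> a mod 4 = 2 \<and> b mod 4 = 0 \<or>
          a mod 4 = 1 \<and> b mod 4 = 1 \<or> a mod 4 = 3 \<and> b mod 4 = 3"
        using that by presburger
      then show ?thesis using t by (auto simp: g_def)
    qed
    have step: "s i + s (i + 2) = 2 * t" for i
    proof -
      have "g a + g (a + 2) = 2 * t" for a
      proof -
        have "a mod 4 = 0 \<and> (a + 2) mod 4 = 2 \<or> a mod 4 = 2 \<and> (a + 2) mod 4 = 0 \<or>
            a mod 4 = 1 \<and> (a + 2) mod 4 = 3 \<or> a mod 4 = 3 \<and> (a + 2) mod 4 = 1"
          by presburger
        then show ?thesis using t by (auto simp: g_def)
      qed
      from this[of "i + c"] show ?thesis by (simp add: s_def ac_simps)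
    qed
    have g_mod: "g (4 * u + i) = g i" for u i by (simp add: g_def)
    have g_vals: "g 1 = t" "g 2 = t + 1" "g 3 = t" "g 4 = t - 1" "g 5 = t"
      by (simp_all add: g_def)
    have vals: "if even l then s 2 = t - 1 \<and> s 3 = t \<and> s (2 * l) = t + 1 \<and> s (2 * l - 1) = t
      else s 2 = t \<and> s 3 = t - 1 \<and> s (2 * l) = t \<and> s (2 * l - 1) = t + 1"
    proof (cases "even l")
      case True
      then obtain u where u: "l = 2 * u" by (elim evenE)
      with True l have "s (2 * l) = g (4 * u + 2)" "s (2 * l - 1) = g (4 * u + 1)"
        by (auto simp: s_def c_def intro!: arg_cong[of _ _ g])
      then have "s (2 * l) = t + 1" "s (2 * l - 1) = t" by (simp_all only: g_mod g_vals)
      moreover have "s 2 = t - 1" "s 3 = t"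
        using True g_vals by (simp_all add: s_def c_def)
      ultimately show ?thesis using True by simp
    next
      case False
      then obtain u where u: "l = 2 * u + 1" by (elim oddE)
      with False have "s (2 * l) = g (4 * u + 3)" "s (2 * l - 1) = g (4 * u + 2)"
        by (auto simp: s_def c_def intro!: arg_cong[of _ _ g])
      then have "s (2 * l) = t" "s (2 * l - 1) = t + 1" by (simp_all only: g_mod g_vals)
      moreover have "s 2 = t" "s 3 = t - 1"
        using False g_vals by (simp_all add: s_def c_def)
      ultimately show ?thesis using False by simp
    qed
    \<comment> \<open>Pairing part \<open>i\<close> with part \<open>2 * l + 2 - i\<close> makes the
      arguments of \<open>g\<close> add up to 2 modulo 4, so each pair has total size
      \<open>2 * t\<close> and the average size is \<open>t\<close>.\<close>
    have "(\<Sum>i = 2..2 * l. s i) = (\<Sum>i = 2..2 * l. s (2 * l + 2 - i))"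
      by (rule sum.atLeastAtMost_rev)
    then have "2 * (\<Sum>i = 2..2 * l. s i) = (\<Sum>i = 2..2 * l. s i + s (2 * l + 2 - i))"
      by (simp add: sum.distrib)
    also have "\<dots> = (\<Sum>i = 2..2 * l. 2 * t)"
    proof (rule sum.cong[OF refl])
      fix i assume "i \<in> {2..2 * l}"
      then have "i + c + (2 * l + 2 - i + c) = 2 * l + 2 + 2 * c" by auto
      moreover have "(2 * l + 2 + 2 * c) mod 4 = 2"
        unfolding c_def by (cases "even l"; simp; presburger)
      ultimately show "s i + s (2 * l + 2 - i) = 2 * t"
        unfolding s_def by (intro g) (simp only:)
    qed
    also have "\<dots> = 2 * ((2 * l - 1) * t)" using l by simp
    finally have "(\<Sum>i = 2..2 * l. s i) = (2 * l - 1) * t" by simp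
    moreover have "(2 * l - 1) * t + 2 * t = (2 * l + 1) * t"
      using l by (simp flip: add_mult_distrib)
    ultimately have sum: "(\<Sum>i = 2..2 * l. s i) + 2 * t = (2 * l + 1) * t" by simp
    show ?thesis
    \<comment> \<open>The excess of \<open>q\<close> over \<open>p\<close> is absorbed by
      \<open>s 2 + s 3 = 2 * t - 1\<close> and
      \<open>s (2 * l) + s (2 * l - 1) = 2 * t + 1\<close>.\<close>
    proof (rule blowup_graph_exists[where s = s and p = p and q = "p + 1"])
      show "n = s (2 * l) + p + (s 2 + (p + 1)) + (\<Sum>i = 2..2 * l. s i)"
        using sum vals t by (auto simp: n p split: if_splits)
    qed (use l t r p vals step in \<open>auto split: if_splits\<close>)
  qed
qed

section \<open>Extremal values and the asymptotic statement\<close>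

lemma ex_r_even:
  assumes l: "l \<ge> 2" and n: "even n" "n > 0"
  shows "ex_r n (odd_cycles l) = n div 2"
proof (rule ex_r_eqI)
  let ?V = "{0, 1} \<times> {..<n div 2} :: (nat \<times> nat) set"
  have "\<exists>G :: nat graph. simple_graph G \<and> card (verts G) = card ?V \<and>
     regular_graph (n div 2) G \<and> (\<forall>H\<in>odd_cycles l. \<not> contains_graph G H)"
  \<comment> \<open>The two sides map to two adjacent vertices of the cycle, so labels differ by
    exactly 1 or -1.\<close>
  proof (rule graph_of_relation[where R = "\<lambda>u v. fst u \<noteq> fst v" and h = "\<lambda>v. int (fst v)"])
    fix u assume "u \<in> ?V"
    then have "{v \<in> ?V. fst u \<noteq> fst v} = {1 - fst u} \<times> {..<n div 2}" by auto
    then show "card {v \<in> ?V. fst u \<noteq> fst v} = n div 2" by (simp add: card_cartesian_product)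
  qed (use l in auto)
  moreover have "card ?V = n" using n by (auto simp: card_cartesian_product elim!: evenE)
  ultimately show "\<exists>G :: nat graph. simple_graph G \<and> card (verts G) = n \<and>
     regular_graph (n div 2) G \<and> (\<forall>H\<in>odd_cycles l. \<not> contains_graph G H)"
    by simp
next
  fix k and G :: "nat graph"
  assume G: "simple_graph G" "card (verts G) = n" "regular_graph k G"
    and free: "\<And>H. H \<in> odd_cycles l \<Longrightarrow> \<not> contains_graph G H"
  have "cycle_graph 3 \<in> odd_cycles l" using l by (auto simp: odd_cycles_def)
  with G n free have "2 * k \<le> n" by (metis card.empty less_irrefl triangle_free_regular_le)
  then show "k \<le> n div 2" by simp
qed

text \<open>The bound on \<open>n\<close> says that the quotient is at least \<open>l + 1\<close>,
  as the construction requires.\<close>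

lemma ex_r_odd:
  assumes "l \<ge> 2" "odd n" "n \<ge> (l + 1) * (2 * l + 1)"
  shows "ex_r n (odd_cycles l) = 2 * (n div (2 * l + 1))"
proof (rule ex_r_eqI)
  from assms(3) have "l + 1 \<le> n div (2 * l + 1)"
    by (subst less_eq_div_iff_mult_less_eq) auto
  with assms(1) show "\<exists>G :: nat graph. simple_graph G \<and> card (verts G) = n \<and>
     regular_graph (2 * (n div (2 * l + 1))) G \<and> (\<forall>H\<in>odd_cycles l. \<not> contains_graph G H)"
    by (rule odd_order_graph_exists)
qed (use assms odd_order_degree_le in blast)

theorem theorem8:
  fixes l :: nat
  assumes "l \<ge> 2"
  shows "(\<forall>n. even n \<and> n > 0 \<longrightarrow> real (ex_r n (odd_cycles l)) = real n / 2) \<and>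
    (\<lambda>n. 2 * real_of_int \<lfloor>real n / real (2 * l + 1)\<rfloor> - real (ex_r n (odd_cycles l)))
      \<in> o[inf at_top (principal {n. odd n})](\<lambda>_. 1)"
proof
  show "\<forall>n. even n \<and> n > 0 \<longrightarrow> real (ex_r n (odd_cycles l)) = real n / 2"
    using ex_r_even[OF assms] by (auto simp: real_of_nat_div)
  \<comment> \<open>The error term is exactly 0 for all large odd \<open>n\<close>, hence
    \<open>o(1)\<close> along the filter of odd numbers.\<close>
  have "2 * real_of_int \<lfloor>real n / real (2 * l + 1)\<rfloor> - real (ex_r n (odd_cycles l)) = 0"
    if "odd n" "n \<ge> (l + 1) * (2 * l + 1)" for n
    using ex_r_odd[OF assms that] by (simp add: floor_divide_of_nat_eq del: of_nat_add of_nat_mult of_nat_Suc)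
  then have "\<forall>\<^sub>F n in inf at_top (principal {n. odd n}).
      2 * real_of_int \<lfloor>real n / real (2 * l + 1)\<rfloor> - real (ex_r n (odd_cycles l)) = 0"
    unfolding eventually_inf_principal eventually_at_top_linorder by blast
  then show "(\<lambda>n. 2 * real_of_int \<lfloor>real n / real (2 * l + 1)\<rfloor> - real (ex_r n (odd_cycles l)))
      \<in> o[inf at_top (principal {n. odd n})](\<lambda>_. 1)"
    by (subst landau_o.small.in_cong[where g = "\<lambda>_. 0"]) simp_all
qed

end
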